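(* Let $\mathcal Q_{\varepsilon,\delta}$ denote the family of $(\varepsilon,\delta)$-approximately differentially private channels. Then for the problem of estimating the mean $\theta(P)=\mathbb E_P[X]$ over the class $\mathcal P_k^d(r)$, $$\inf_{Q\in\mathcal Q_{\varepsilon,\delta}}\ \sup_{P\in\mathcal P^d_k(r)}\ \mathbb E_{P,Q}\left[\big\|\widehat\theta(X_{1:n})-\mathbb E_P[X]\big\|_2^2\right]\ \gtrsim\ \frac{r^2}{n}+r^2\min\left\{\left(\frac{\min\{d^2,\log^2\frac1\delta\}}{n^2\varepsilon^2}\right)^{\frac{k-1}{k}},\,1\right\}.$$
   Context: $\mathcal P_k^d(r)$ is the set of probability distributions $P$ supported on $\mathbb R^d$ with $\mathbb E_P[\|X\|_2^k]\le r^k$, where $k>1$ and $r>0$ are fixed. A channel $Q$ is a Markov kernel from $(\mathbb R^d)^n$ to $\mathbb R^d$. Given $P$ and $Q$, $X_1,\dots,X_n$ are drawn i.i.d. from $P$ and then, conditionally on $X_{1:n}=(X_1,\dots,X_n)$, the estimator $\widehat\theta(X_{1:n})$ is drawn from $Q(\cdot\mid X_{1:n})$; $\mathbb E_{P,Q}$ is expectation over both. A channel $Q$ is $(\varepsilon,\delta)$-approximately differentially private if $Q(A\mid x_{1:n})\le e^{\varepsilon}Q(A\mid x'_{1:n})+\delta$ for all measurable $A$ and all $x_{1:n},x'_{1:n}$ differing in only one observation. When $\delta=0$, $\log\frac1\delta$ is read as $+\infty$. The notation $a_n\gtrsim b_n$ means that $a_n\ge c\,b_n$ for some constant $c>0$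 and for all $n\ge1$. *)

theory Defs
  imports "HOL-Probability.Probability"
begin

(* The dimension d is quantified inside the theorem, so R^d is the product space over the
   index set {..<d}: its points are the functions nat => real that are extensional on {..<d}. *)

definition Rd :: "nat \<Rightarrow> (nat \<Rightarrow> real) measure" where
  "Rd d = (\<Pi>\<^sub>M i\<in>{..<d}. borel)"

definition enorm :: "nat \<Rightarrow> (nat \<Rightarrow> real) \<Rightarrow> real" where
  "enorm d x = L2_set x {..<d}"

definition mean :: "nat \<Rightarrow> (nat \<Rightarrow> real) measure \<Rightarrow> (nat \<Rightarrow> real)" where
  "mean d P = (\<lambda>i\<in>{..<d}. \<integral>x. x i \<partial>P)"

definition moment_class :: "nat \<Rightarrow> real \<Rightarrow> real \<Rightarrow> (nat \<Rightarrow> real) measure set" where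
  "moment_class d k r =
     {P \<in> space (prob_algebra (Rd d)).
        (\<integral>\<^sup>+x. ennreal (enorm d x powr k) \<partial>P) \<le> ennreal (r powr k)}"

definition samples :: "nat \<Rightarrow> nat \<Rightarrow> (nat \<Rightarrow> nat \<Rightarrow> real) measure" where
  "samples d n = (\<Pi>\<^sub>M j\<in>{..<n}. Rd d)"

definition channels :: "nat \<Rightarrow> nat \<Rightarrow> ((nat \<Rightarrow> nat \<Rightarrow> real) \<Rightarrow> (nat \<Rightarrow> real) measure) set" where
  "channels d n = samples d n \<rightarrow>\<^sub>M prob_algebra (Rd d)"

definition neighbours :: "nat \<Rightarrow> (nat \<Rightarrow> nat \<Rightarrow> real) \<Rightarrow> (nat \<Rightarrow> nat \<Rightarrow> real) \<Rightarrow> bool" where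
  "neighbours n x x' \<longleftrightarrow> card {j \<in> {..<n}. x j \<noteq> x' j} = 1"

definition approx_dp_channels ::
  "nat \<Rightarrow> nat \<Rightarrow> real \<Rightarrow> real \<Rightarrow> ((nat \<Rightarrow> nat \<Rightarrow> real) \<Rightarrow> (nat \<Rightarrow> real) measure) set" where
  "approx_dp_channels d n \<epsilon> \<delta> =
     {Q \<in> channels d n.
        \<forall>x \<in> space (samples d n). \<forall>x' \<in> space (samples d n). neighbours n x x' \<longrightarrow>
          (\<forall>A \<in> sets (Rd d). measure (Q x) A \<le> exp \<epsilon> * measure (Q x') A + \<delta>)}"

definition risk ::
  "nat \<Rightarrow> nat \<Rightarrow> ((nat \<Rightarrow> nat \<Rightarrow> real) \<Rightarrow> (nat \<Rightarrow> real) measure) \<Rightarrow> (nat \<Rightarrow> real) measure \<Rightarrow> ennreal" where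
  "risk d n Q P =
     (\<integral>\<^sup>+x. (\<integral>\<^sup>+t. ennreal ((enorm d (\<lambda>i. t i - mean d P i))\<^sup>2) \<partial>Q x) \<partial>(\<Pi>\<^sub>M j\<in>{..<n}. P))"

definition minimax_risk :: "nat \<Rightarrow> nat \<Rightarrow> real \<Rightarrow> real \<Rightarrow> real \<Rightarrow> real \<Rightarrow> ennreal" where
  "minimax_risk d n k r \<epsilon> \<delta> =
     (INF Q \<in> approx_dp_channels d n \<epsilon> \<delta>. SUP P \<in> moment_class d k r. risk d n Q P)"

(* min {d^2, log^2 (1/delta)}, where log (1/0) is read as infinity. *)
definition min_dim_log :: "nat \<Rightarrow> real \<Rightarrow> real" where
  "min_dim_log d \<delta> =
     (if \<delta> = 0 then (real d)\<^sup>2 else min ((real d)\<^sup>2) ((ln (1 / \<delta>))\<^sup>2))"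

definition lower_rate :: "nat \<Rightarrow> nat \<Rightarrow> real \<Rightarrow> real \<Rightarrow> real \<Rightarrow> real \<Rightarrow> real" where
  "lower_rate d n k r \<epsilon> \<delta> =
     r\<^sup>2 / real n
     + r\<^sup>2 * min ((min_dim_log d \<delta> / ((real n)\<^sup>2 * \<epsilon>\<^sup>2)) powr ((k - 1) / k)) 1"

(* The implicit constant of the bound is written as c (delta / epsilon^2) with c positive and
   antitone.  It is the same for all d, n, r, and for all epsilon, delta for which
   delta / epsilon^2 stays bounded; in particular c 0 serves every epsilon when delta = 0.
   A constant common to all epsilon, delta does not exist: for delta = 1/2, epsilon = 1/n,
   d = 1, k = 2 the rate is of order r^2, whereas averaging a random subsample that keeps each
   observation with probability 1/2 is (0, 1/2)-private and has risk of order r^2 / n. *)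

end

theory Submission
  imports Defs
begin

text \<open>
  Put mass \<open>q\<close> on \<open>s v\<close> and mass \<open>1 - q\<close> on the origin, where \<open>v\<close> is a sign vector divided by
  \<open>\<surd>d\<close> and \<open>s = r q powr (- 1 / k)\<close> exhausts the moment budget; the mean \<open>q s v\<close> has norm
  \<open>r q powr ((k - 1) / k)\<close>. A sample differs from the all-zero data set in about \<open>n q\<close> places, so by group
  privacy every event has at most \<open>e\<^sup>b\<close> times its probability under the all-zero data set, up to a
  small slack, once \<open>n q \<epsilon>\<close> is small compared with \<open>b\<close>. The output on the all-zero data set does not
  depend on \<open>v\<close>, so for a uniformly random \<open>v\<close> it is close to the mean with probability
  exponentially small in \<open>d\<close>. Taking \<open>b\<close> a small multiple of \<open>min {d, log (1/\<delta>)}\<close> keeps both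
  \<open>e\<^sup>b\<close> times this probability and the slack, which is about \<open>\<delta> (e\<^sup>b - 1) / \<epsilon>\<close>, bounded away from 1;
  the bound on the slack is where \<open>\<delta> / \<epsilon>\<^sup>2\<close> enters. The term \<open>r\<^sup>2 / n\<close> is the two-point bound for
  \<open>\<plusminus> r e\<^sub>1\<close> with probabilities \<open>1/2 \<plusminus> h\<close>, where \<open>h\<close> is of order \<open>1 / \<surd>n\<close>.
\<close>

section \<open>Two-point distributions and samples drawn from them\<close>

definition two_point :: "nat \<Rightarrow> (bool \<Rightarrow> nat \<Rightarrow> real) \<Rightarrow> real \<Rightarrow> (nat \<Rightarrow> real) measure" where
  "two_point d f q = distr (measure_pmf (bernoulli_pmf q)) (Rd d) f"

text \<open>Records which observations equal \<open>f True\<close>. As this set is finite,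
  expectations over samples become finite weighted sums.\<close>

definition coin_flips :: "nat \<Rightarrow> (nat \<Rightarrow> bool) set" where
  "coin_flips n = {..<n} \<rightarrow>\<^sub>E UNIV"

definition weight :: "nat \<Rightarrow> real \<Rightarrow> (nat \<Rightarrow> bool) \<Rightarrow> real" where
  "weight n q \<omega> = (\<Prod>j<n. if \<omega> j then q else 1 - q)"

definition dataset :: "nat \<Rightarrow> (bool \<Rightarrow> nat \<Rightarrow> real) \<Rightarrow> (nat \<Rightarrow> bool) \<Rightarrow> nat \<Rightarrow> nat \<Rightarrow> real" where
  "dataset n f \<omega> = (\<lambda>j\<in>{..<n}. f (\<omega> j))"

lemma space_Rd: "space (Rd d) = extensional {..<d}"
  by (simp add: Rd_def space_PiM PiE_def)

lemma space_samples: "space (samples d n) = {..<n} \<rightarrow>\<^sub>E space (Rd d)"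
  by (simp add: samples_def space_PiM)

lemma finite_coin_flips [simp]: "finite (coin_flips n)"
  by (simp add: coin_flips_def finite_PiE)

lemma card_coin_flips: "card (coin_flips n) = 2 ^ n"
  by (simp add: coin_flips_def card_PiE)

lemma weight_nonneg: "0 \<le> q \<Longrightarrow> q \<le> 1 \<Longrightarrow> 0 \<le> weight n q \<omega>"
  by (auto simp: weight_def intro!: prod_nonneg)

lemma dataset_in_space: "(\<And>b. f b \<in> space (Rd d)) \<Longrightarrow> dataset n f \<omega> \<in> space (samples d n)"
  by (auto simp: dataset_def space_samples)

lemma sum_weight: "(\<Sum>\<omega>\<in>coin_flips n. weight n q \<omega>) = 1"
proof -
  have "(\<Sum>\<omega>\<in>coin_flips n. weight n q \<omega>) = (\<Prod>j<n. \<Sum>b\<in>UNIV. if b then q else 1 - q)"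
    unfolding coin_flips_def weight_def by (subst prod_sum_PiE) auto
  then show ?thesis by (simp add: UNIV_bool)
qed

text \<open>Mean of the binomial distribution, by linearity. Multiplying by the indicator of one
  coin changes only the factor of that coin, so the sum over all outcomes still factorizes.\<close>

lemma sum_weight_card:
  "(\<Sum>\<omega>\<in>coin_flips n. weight n q \<omega> * real (card {j\<in>{..<n}. \<omega> j})) = real n * q"
proof -
  have single: "(\<Sum>\<omega>\<in>coin_flips n. weight n q \<omega> * of_bool (\<omega> i)) = q" if i: "i < n" for i
  proof -
    have "weight n q \<omega> * of_bool (\<omega> i)
        = (\<Prod>j<n. (if \<omega> j then q else 1 - q) * (if j = i then of_bool (\<omega> j) else 1))" for \<omega>
      using i by (simp add: weight_def prod.distrib prod.delta)
    then have "(\<Sum>\<omega>\<in>coin_flips n. weight n q \<omega> * of_bool (\<omega> i))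
        = (\<Prod>j<n. \<Sum>b\<in>UNIV. (if b then q else 1 - q) * (if j = i then of_bool b else 1))"
      unfolding coin_flips_def by (subst prod_sum_PiE) auto
    also have "\<dots> = (\<Prod>j<n. if j = i then q else 1)"
      by (intro prod.cong) (auto simp: UNIV_bool)
    finally show ?thesis using i by (simp add: prod.delta)
  qed
  have card: "real (card {j\<in>{..<n}. \<omega> j}) = (\<Sum>i<n. of_bool (\<omega> i))" for \<omega>
    by (simp add: of_bool_def sum.If_cases Int_def)
  have "(\<Sum>\<omega>\<in>coin_flips n. weight n q \<omega> * real (card {j\<in>{..<n}. \<omega> j}))
      = (\<Sum>i<n. \<Sum>\<omega>\<in>coin_flips n. weight n q \<omega> * of_bool (\<omega> i))"
    unfolding card sum_distrib_left by (rule sum.swap)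
  also have "\<dots> = (\<Sum>i<n. q)" by (intro sum.cong refl single) simp
  finally show ?thesis by simp
qed

text \<open>The i.i.d. sample is the image of n independent coins under \<open>dataset\<close>: the
  two measures agree on boxes, which determine a product measure. The integral over the coins is
  then a finite sum.\<close>

lemma nn_integral_two_point_power:
  assumes q: "0 \<le> q" "q \<le> 1" and f: "\<And>b. f b \<in> space (Rd d)"
    and g: "g \<in> borel_measurable (samples d n)"
  shows "(\<integral>\<^sup>+x. g x \<partial>(\<Pi>\<^sub>M j\<in>{..<n}. two_point d f q))
       = (\<Sum>\<omega>\<in>coin_flips n. ennreal (weight n q \<omega>) * g (dataset n f \<omega>))"
proof -
  \<comment> \<open>The default \<open>undefined\<close> makes every outcome of positive probability
    extensional, so the support lies in \<open>coin_flips n\<close>.\<close>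
  let ?B = "Pi_pmf {..<n} undefined (\<lambda>_. bernoulli_pmf q)"
  have fm: "f \<in> measure_pmf (bernoulli_pmf q) \<rightarrow>\<^sub>M Rd d" using f by simp
  have ds: "dataset n f \<in> measure_pmf ?B \<rightarrow>\<^sub>M samples d n"
    using dataset_in_space[OF f] by simp
  have ps: "prob_space (two_point d f q)"
    unfolding two_point_def by (rule measure_pmf.prob_space_distr[OF fm])
  have sets: "sets (\<Pi>\<^sub>M j\<in>{..<n}. two_point d f q) = sets (samples d n)"
    unfolding samples_def two_point_def by (rule sets_PiM_cong) auto
  interpret product_sigma_finite "\<lambda>_::nat. two_point d f q"
    by (intro product_sigma_finite.intro prob_space_imp_sigma_finite ps)
  have eq: "distr (measure_pmf ?B) (samples d n) (dataset n f) = (\<Pi>\<^sub>M j\<in>{..<n}. two_point d f q)"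
  proof (rule PiM_eqI)
    fix A :: "nat \<Rightarrow> (nat \<Rightarrow> real) set"
    assume A: "\<And>i. i \<in> {..<n} \<Longrightarrow> A i \<in> sets (two_point d f q)"
    have pre: "dataset n f -` Pi\<^sub>E {..<n} A = Pi {..<n} (\<lambda>j. f -` A j)"
      by (auto simp: dataset_def PiE_iff)
    have box: "Pi\<^sub>E {..<n} A \<in> sets (samples d n)"
      unfolding samples_def using A by (intro sets_PiM_I_finite) (auto simp: two_point_def)
    have "emeasure (distr (measure_pmf ?B) (samples d n) (dataset n f)) (Pi\<^sub>E {..<n} A)
        = emeasure (measure_pmf ?B) (Pi {..<n} (\<lambda>j. f -` A j))"
      using ds box by (simp add: emeasure_distr pre)
    also have "\<dots> = ennreal (\<Prod>j<n. measure (measure_pmf (bernoulli_pmf q)) (f -` A j))"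
      by (simp add: measure_pmf.emeasure_eq_measure measure_Pi_pmf_Pi)
    also have "\<dots> = (\<Prod>j<n. emeasure (measure_pmf (bernoulli_pmf q)) (f -` A j))"
      by (simp add: measure_pmf.emeasure_eq_measure prod_ennreal)
    also have "\<dots> = (\<Prod>j<n. emeasure (two_point d f q) (A j))"
      using A fm by (intro prod.cong) (auto simp: two_point_def emeasure_distr)
    finally show "emeasure (distr (measure_pmf ?B) (samples d n) (dataset n f)) (Pi\<^sub>E {..<n} A)
        = (\<Prod>j<n. emeasure (two_point d f q) (A j))" .
  qed (auto simp: sets)
  have out: "pmf ?B \<omega> = 0" if "\<omega> \<notin> coin_flips n" for \<omega>
    using that by (auto simp: coin_flips_def PiE_iff extensional_def intro!: pmf_Pi_outside)
  have pmf: "pmf ?B \<omega> = weight n q \<omega>" if "\<omega> \<in> coin_flips n" for \<omega>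
  proof -
    have "pmf ?B \<omega> = (\<Prod>j<n. pmf (bernoulli_pmf q) (\<omega> j))"
      using that by (intro pmf_Pi') (auto simp: coin_flips_def PiE_iff extensional_def)
    also have "\<dots> = weight n q \<omega>"
      unfolding weight_def using q by (intro prod.cong) (auto split: if_splits)
    finally show ?thesis .
  qed
  have "(\<integral>\<^sup>+x. g x \<partial>(\<Pi>\<^sub>M j\<in>{..<n}. two_point d f q)) = (\<integral>\<^sup>+\<omega>. g (dataset n f \<omega>) \<partial>measure_pmf ?B)"
    using ds g by (simp add: eq[symmetric] nn_integral_distr)
  also have "\<dots> = (\<Sum>\<omega>\<in>coin_flips n. ennreal (pmf ?B \<omega>) * g (dataset n f \<omega>))"
  proof -
    have "(\<integral>\<^sup>+\<omega>. g (dataset n f \<omega>) \<partial>measure_pmf ?B)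
        = (\<integral>\<^sup>+\<omega>. g (dataset n f \<omega>) * indicator (coin_flips n) \<omega> \<partial>measure_pmf ?B)"
      using out by (intro nn_integral_cong_AE)
        (auto simp: AE_measure_pmf_iff set_pmf_eq split: split_indicator)
    also have "\<dots> = (\<Sum>\<omega>\<in>coin_flips n. g (dataset n f \<omega>) * indicator (coin_flips n) \<omega> * ennreal (pmf ?B \<omega>))"
      by (intro nn_integral_measure_pmf_support) auto
    also have "\<dots> = (\<Sum>\<omega>\<in>coin_flips n. ennreal (pmf ?B \<omega>) * g (dataset n f \<omega>))"
      by (intro sum.cong) (auto simp: mult.commute)
    finally show ?thesis .
  qed
  also have "\<dots> = (\<Sum>\<omega>\<in>coin_flips n. ennreal (weight n q \<omega>) * g (dataset n f \<omega>))"
    by (intro sum.cong) (auto simp: pmf)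
  finally show ?thesis .
qed

section \<open>Moments, means and risks of two-point distributions\<close>

lemma measurable_coordinate_Rd [measurable]: "i < d \<Longrightarrow> (\<lambda>x. x i) \<in> borel_measurable (Rd d)"
  unfolding Rd_def by measurable

lemma enorm_sq: "(enorm d x)\<^sup>2 = (\<Sum>i<d. (x i)\<^sup>2)"
  by (simp add: enorm_def L2_set_def sum_nonneg)

lemma measurable_sq_dist [measurable]:
  "(\<lambda>t. \<Sum>i<d. (t i - y i)\<^sup>2) \<in> borel_measurable (Rd d)" for y :: "nat \<Rightarrow> real"
  by measurable

lemma two_point_in_moment_class:
  assumes q: "0 \<le> q" "q \<le> 1" and f: "\<And>b. f b \<in> space (Rd d)"
    and moment: "q * enorm d (f True) powr k + (1 - q) * enorm d (f False) powr k \<le> r powr k"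
  shows "two_point d f q \<in> moment_class d k r"
proof -
  have fm: "f \<in> measure_pmf (bernoulli_pmf q) \<rightarrow>\<^sub>M Rd d" using f by simp
  have "(\<lambda>x. ennreal (enorm d x powr k)) \<in> borel_measurable (Rd d)"
    unfolding enorm_def L2_set_def by measurable
  then have "(\<integral>\<^sup>+x. ennreal (enorm d x powr k) \<partial>two_point d f q)
      = ennreal (q * enorm d (f True) powr k + (1 - q) * enorm d (f False) powr k)"
    using q fm by (simp add: two_point_def nn_integral_distr mult.commute flip: ennreal_mult'' ennreal_plus)
  with moment have "(\<integral>\<^sup>+x. ennreal (enorm d x powr k) \<partial>two_point d f q) \<le> ennreal (r powr k)"
    by (simp add: ennreal_leI)
  then show ?thesis
    using measure_pmf.prob_space_distr[OF fm]
    by (simp add: moment_class_def space_prob_algebra two_point_def)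
qed

lemma mean_two_point:
  assumes q: "0 \<le> q" "q \<le> 1" and f: "\<And>b. f b \<in> space (Rd d)" and i: "i < d"
  shows "mean d (two_point d f q) i = q * f True i + (1 - q) * f False i"
proof -
  have fm: "f \<in> measure_pmf (bernoulli_pmf q) \<rightarrow>\<^sub>M Rd d" using f by simp
  show ?thesis using q fm i
    by (simp add: mean_def two_point_def integral_distr mult.commute)
qed

lemma risk_two_point:
  assumes q: "0 \<le> q" "q \<le> 1" and f: "\<And>b. f b \<in> space (Rd d)" and Q: "Q \<in> channels d n"
  shows "risk d n Q (two_point d f q) = (\<Sum>\<omega>\<in>coin_flips n. ennreal (weight n q \<omega>) *
     (\<integral>\<^sup>+t. ennreal (\<Sum>i<d. (t i - (q * f True i + (1 - q) * f False i))\<^sup>2) \<partial>Q (dataset n f \<omega>)))"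
proof -
  have Qm: "Q \<in> samples d n \<rightarrow>\<^sub>M subprob_algebra (Rd d)"
    using Q unfolding channels_def by (rule measurable_prob_algebraD)
  define y where "y = (\<lambda>i. q * f True i + (1 - q) * f False i)"
  have "(enorm d (\<lambda>i. t i - mean d (two_point d f q) i))\<^sup>2 = (\<Sum>i<d. (t i - y i)\<^sup>2)" for t
    unfolding enorm_sq y_def by (intro sum.cong) (auto simp: mean_two_point[OF q f])
  moreover have "(\<lambda>x. \<integral>\<^sup>+t. ennreal (\<Sum>i<d. (t i - y i)\<^sup>2) \<partial>Q x) \<in> borel_measurable (samples d n)"
    by (rule nn_integral_measurable_subprob_algebra2[OF _ Qm]) measurable
  ultimately show ?thesis
    unfolding risk_def
    by (simp add: nn_integral_two_point_power[OF q f]) (simp add: y_def)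
qed

lemma channel_prob_space:
  assumes "Q \<in> channels d n" "x \<in> space (samples d n)"
  shows "prob_space (Q x)" "sets (Q x) = sets (Rd d)" "space (Q x) = space (Rd d)"
  using measurable_space[OF assms(1)[unfolded channels_def] assms(2)]
  by (auto simp: space_prob_algebra dest: sets_eq_imp_space_eq)

section \<open>Group privacy and averages over samples\<close>

text \<open>The differing observations are replaced one at a time. Each replacement multiplies the
  slack collected so far by \<open>exp \<epsilon>\<close> and adds \<delta>, hence the geometric
  sum.\<close>

lemma group_privacy:
  assumes Q: "Q \<in> approx_dp_channels d n \<epsilon> \<delta>" and A: "A \<in> sets (Rd d)"
    and x: "x \<in> space (samples d n)" and x': "x' \<in> space (samples d n)"
    and m: "card {j\<in>{..<n}. x j \<noteq> x' j} = m"
  shows "measure (Q x) A \<le> exp (real m * \<epsilon>) * measure (Q x') A + \<delta> * (\<Sum>i<m. exp (real i * \<epsilon>))"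
  using x m
proof (induction m arbitrary: x)
  case 0
  then have "x j = x' j" if "j < n" for j using that by auto
  then have "x = x'"
    using 0 x' by (intro PiE_ext[of x "{..<n}" "\<lambda>_. space (Rd d)" x']) (auto simp: space_samples)
  then show ?case by simp
next
  case (Suc m)
  let ?D = "{j\<in>{..<n}. x j \<noteq> x' j}"
  have "?D \<noteq> {}" using Suc.prems(2) by (metis card.empty nat.distinct(1))
  then obtain j where j: "j < n" "x j \<noteq> x' j" by auto
  define y where "y = x(j := x' j)"
  have y: "y \<in> space (samples d n)"
    using Suc.prems(1) x' j by (auto simp: y_def space_samples PiE_iff extensional_def)
  have "{i\<in>{..<n}. y i \<noteq> x' i} = ?D - {j}" by (auto simp: y_def)
  then have "card {i\<in>{..<n}. y i \<noteq> x' i} = m" using Suc.prems(2) j by simp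
  note IH = Suc.IH[OF y this]
  have "{i\<in>{..<n}. x i \<noteq> y i} = {j}" using j by (auto simp: y_def)
  then have "neighbours n x y" by (simp add: neighbours_def)
  then have "measure (Q x) A \<le> exp \<epsilon> * measure (Q y) A + \<delta>"
    using Q A Suc.prems(1) y by (auto simp: approx_dp_channels_def)
  also have "\<dots> \<le> exp \<epsilon> * (exp (real m * \<epsilon>) * measure (Q x') A + \<delta> * (\<Sum>i<m. exp (real i * \<epsilon>))) + \<delta>"
    using IH by simp
  also have "\<dots> = exp (real (Suc m) * \<epsilon>) * measure (Q x') A + \<delta> * (\<Sum>i<Suc m. exp (real i * \<epsilon>))"
    unfolding sum.lessThan_Suc_shift by (simp add: algebra_simps exp_add sum_distrib_left)
  finally show ?case .
qed

text \<open>In the closed form of the geometric series the denominator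
  \<open>exp \<epsilon> - 1\<close> is at least \<epsilon>. The \<open>- 1\<close> in the numerator
  is kept so that the slack stays small when the exponent is small.\<close>

lemma sum_exp_le:
  assumes "0 < \<epsilon>"
  shows "(\<Sum>i<m. exp (real i * \<epsilon>)) \<le> (exp (real m * \<epsilon>) - 1) / \<epsilon>"
proof -
  have e: "\<epsilon> \<le> exp \<epsilon> - 1" using exp_ge_add_one_self[of \<epsilon>] by linarith
  have "\<epsilon> * (\<Sum>i<m. exp (real i * \<epsilon>)) \<le> (exp \<epsilon> - 1) * (\<Sum>i<m. exp (real i * \<epsilon>))"
    using e by (intro mult_right_mono sum_nonneg) auto
  also have "\<dots> = exp (real m * \<epsilon>) - 1"
    by (simp add: exp_of_nat_mult power_diff_1_eq)
  finally show ?thesis using assms by (simp add: pos_le_divide_eq mult.commute)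
qed

text \<open>
  Group privacy handles the samples with at most \<open>b / \<epsilon>\<close> nonzero observations and Markov's inequality
  the others; the slack vanishes when no observation differs, hence the factor \<open>exp b - 1\<close>.
\<close>

lemma private_average:
  assumes Q: "Q \<in> approx_dp_channels d n \<epsilon> \<delta>" and A: "A \<in> sets (Rd d)"
    and f: "\<And>b. f b \<in> space (Rd d)" and q: "0 \<le> q" "q \<le> 1"
    and \<epsilon>: "0 < \<epsilon>" and \<delta>: "0 \<le> \<delta>" and b: "0 < b"
  shows "(\<Sum>\<omega>\<in>coin_flips n. weight n q \<omega> * measure (Q (dataset n f \<omega>)) A)
     \<le> exp b * measure (Q (dataset n f (\<lambda>_. False))) A + \<delta> * (exp b - 1) / \<epsilon> + real n * q * \<epsilon> / b"
proof -
  define R where "R = exp b * measure (Q (dataset n f (\<lambda>_. False))) A + \<delta> * (exp b - 1) / \<epsilon>"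
  have Qc: "Q \<in> channels d n" using Q by (simp add: approx_dp_channels_def)
  have R0: "0 \<le> R" using b \<epsilon> \<delta> by (simp add: R_def)
  have pointwise: "measure (Q (dataset n f \<omega>)) A \<le> R + real (card {j\<in>{..<n}. \<omega> j}) * \<epsilon> / b" for \<omega>
  proof -
    define N where "N = card {j\<in>{..<n}. \<omega> j}"
    show ?thesis
    proof (cases "real N * \<epsilon> \<le> b")
      case True
      define m where "m = card {j\<in>{..<n}. dataset n f \<omega> j \<noteq> dataset n f (\<lambda>_. False) j}"
      \<comment> \<open>Only an inequality, since \<open>f True\<close> and \<open>f False\<close>
        may coincide.\<close>
      have "m \<le> N" unfolding m_def N_def
        by (rule card_mono) (auto simp: dataset_def intro: ccontr)
      then have mb: "real m * \<epsilon> \<le> b"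
        using True \<epsilon> by (meson mult_right_mono of_nat_le_iff less_imp_le order_trans)
      have "measure (Q (dataset n f \<omega>)) A \<le> exp (real m * \<epsilon>) * measure (Q (dataset n f (\<lambda>_. False))) A
          + \<delta> * (\<Sum>i<m. exp (real i * \<epsilon>))"
        by (rule group_privacy[OF Q A _ _ m_def[symmetric]]) (rule dataset_in_space[OF f])+
      also have "\<dots> \<le> exp b * measure (Q (dataset n f (\<lambda>_. False))) A + \<delta> * ((exp b - 1) / \<epsilon>)"
      proof (intro add_mono mult_right_mono mult_left_mono \<delta>)
        have "(\<Sum>i<m. exp (real i * \<epsilon>)) \<le> (exp (real m * \<epsilon>) - 1) / \<epsilon>" by (rule sum_exp_le[OF \<epsilon>])
        also have "\<dots> \<le> (exp b - 1) / \<epsilon>" using mb \<epsilon> by (intro divide_right_mono) auto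
        finally show "(\<Sum>i<m. exp (real i * \<epsilon>)) \<le> (exp b - 1) / \<epsilon>" .
      qed (use mb in auto)
      finally have "measure (Q (dataset n f \<omega>)) A \<le> R" by (simp add: R_def)
      moreover have "0 \<le> real N * \<epsilon> / b" using \<epsilon> b by simp
      ultimately show ?thesis by (simp add: N_def)
    next
      \<comment> \<open>Here the last summand is at least 1 and so dominates any probability; after
        averaging this is Markov's inequality.\<close>
      case False
      then have "1 \<le> real N * \<epsilon> / b" using b by simp
      moreover have "measure (Q (dataset n f \<omega>)) A \<le> 1"
        by (intro prob_space.prob_le_1 channel_prob_space(1)[OF Qc] dataset_in_space f)
      ultimately show ?thesis using R0 by (simp add: N_def)
    qed
  qed
  have "(\<Sum>\<omega>\<in>coin_flips n. weight n q \<omega> * measure (Q (dataset n f \<omega>)) A)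
      \<le> (\<Sum>\<omega>\<in>coin_flips n. weight n q \<omega> * (R + real (card {j\<in>{..<n}. \<omega> j}) * \<epsilon> / b))"
    by (intro sum_mono mult_left_mono pointwise weight_nonneg q)
  also have "\<dots> = R * (\<Sum>\<omega>\<in>coin_flips n. weight n q \<omega>)
      + (\<Sum>\<omega>\<in>coin_flips n. weight n q \<omega> * real (card {j\<in>{..<n}. \<omega> j})) * (\<epsilon> / b)"
    by (simp add: sum_distrib_left sum_distrib_right sum.distrib algebra_simps)
  also have "\<dots> = R + real n * q * \<epsilon> / b"
    by (simp only: sum_weight sum_weight_card) simp
  finally show ?thesis by (simp add: R_def)
qed

section \<open>Lower bound forced by privacy, with random sign vectors\<close>

definition signs :: "nat \<Rightarrow> (nat \<Rightarrow> real) set" where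
  "signs d = {..<d} \<rightarrow>\<^sub>E {-1, 1}"

lemma finite_signs [simp]: "finite (signs d)"
  by (simp add: signs_def finite_PiE)

lemma card_signs: "card (signs d) = 2 ^ d"
  by (simp add: signs_def card_PiE numeral_2_eq_2)

text \<open>One factor of the Chernoff bound: 3 is the exponential parameter and 1/20 is 3 times the
  squared radius 1/60 allowed per coordinate. Any \<tau> is at distance at least 1 from one of the
  two signs, whose term thus carries a factor of at most \<open>exp (-3)\<close>. What matters is
  that 6/5 is below 2, the number of signs.\<close>

lemma exp_sq_dist_signs_le:
  "exp (1/20 - 3 * (\<tau> + 1)\<^sup>2) + exp (1/20 - 3 * (\<tau> - 1)\<^sup>2) \<le> (6/5 :: real)"
proof -
  have pos: "exp (1/20 - 3 * (\<tau> + 1)\<^sup>2) + exp (1/20 - 3 * (\<tau> - 1)\<^sup>2) \<le> exp (1/20) * (1 + exp (-3))"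
    if "0 \<le> \<tau>" for \<tau> :: real
  proof -
    have "1 \<le> (\<tau> + 1)\<^sup>2" using that by (simp add: power2_eq_square algebra_simps)
    then have "exp (1/20 - 3 * (\<tau> + 1)\<^sup>2) \<le> exp (1/20 + -3)" by simp
    moreover have "exp (1/20 - 3 * (\<tau> - 1)\<^sup>2) \<le> exp (1/20)" by simp
    ultimately show ?thesis unfolding exp_add distrib_left by linarith
  qed
  have "exp (1/20 - 3 * (\<tau> + 1)\<^sup>2) + exp (1/20 - 3 * (\<tau> - 1)\<^sup>2) \<le> exp (1/20) * (1 + exp (-3))"
  proof (cases "0 \<le> \<tau>")
    case False
    have "(- \<tau> + 1)\<^sup>2 = (\<tau> - 1)\<^sup>2" "(- \<tau> - 1)\<^sup>2 = (\<tau> + 1)\<^sup>2"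
      by (simp_all add: power2_eq_square algebra_simps)
    then show ?thesis using pos[of "- \<tau>"] False by simp
  qed (rule pos)
  also have "\<dots> \<le> (1 + 1/20 + (1/20)\<^sup>2) * (1 + 1/8)"
  proof (intro mult_mono add_mono)
    have "(2::real) ^ 3 \<le> exp 1 ^ 3"
      using exp_ge_add_one_self[of 1] by (intro power_mono) auto
    also have "\<dots> = exp 3" by (simp flip: exp_of_nat_mult)
    finally show "exp (- 3) \<le> (1/8 :: real)" by (simp add: exp_minus divide_simps)
    show "exp (1/20) \<le> (1 + 1/20 + (1/20)\<^sup>2 :: real)"
      by (rule exp_bound) auto
  qed auto
  also have "\<dots> \<le> (6/5 :: real)" by (simp add: power2_eq_square)
  finally show ?thesis .
qed

text \<open>A Chernoff bound for uniformly random signs, used in place of a packing of the sphere.\<close>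

lemma card_signs_near_le:
  assumes "0 < m"
  shows "real (card {v\<in>signs d. (\<Sum>i<d. (t i - m * v i)\<^sup>2) \<le> m\<^sup>2 * real d / 60}) \<le> (6/5) ^ d"
proof -
  have scale: "(\<Sum>i<d. (t i - m * v i)\<^sup>2) = m\<^sup>2 * (\<Sum>i<d. (t i / m - v i)\<^sup>2)" for v
  proof -
    have "t i - m * v i = m * (t i / m - v i)" for i using assms by (simp add: field_simps)
    then show ?thesis by (simp add: power_mult_distrib sum_distrib_left)
  qed
  have "real (card {v\<in>signs d. (\<Sum>i<d. (t i - m * v i)\<^sup>2) \<le> m\<^sup>2 * real d / 60})
      = (\<Sum>v\<in>signs d. if (\<Sum>i<d. (t i - m * v i)\<^sup>2) \<le> m\<^sup>2 * real d / 60 then 1 else 0)"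
    by (simp add: sum.If_cases Int_def)
  \<comment> \<open>Whenever v is near, the exponent, 3 times the difference of d / 60 and the
    squared distance from \<open>t / m\<close> to v, is nonnegative, so the product is at least
    1.\<close>
  also have "\<dots> \<le> (\<Sum>v\<in>signs d. \<Prod>i<d. exp (1/20 - 3 * (t i / m - v i)\<^sup>2))"
  proof (rule sum_mono)
    fix v
    have "(\<Prod>i<d. exp (1/20 - 3 * (t i / m - v i)\<^sup>2)) = exp (real d / 20 - 3 * (\<Sum>i<d. (t i / m - v i)\<^sup>2))"
      by (simp add: sum_subtractf sum_distrib_left flip: exp_sum)
    moreover have "1 \<le> exp (real d / 20 - 3 * (\<Sum>i<d. (t i / m - v i)\<^sup>2))"
      if "m\<^sup>2 * (\<Sum>i<d. (t i / m - v i)\<^sup>2) \<le> m\<^sup>2 * (real d / 60)"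
    proof -
      have "(\<Sum>i<d. (t i / m - v i)\<^sup>2) \<le> real d / 60" using that assms by simp
      then show ?thesis by simp
    qed
    ultimately show "(if (\<Sum>i<d. (t i - m * v i)\<^sup>2) \<le> m\<^sup>2 * real d / 60 then 1 else 0)
        \<le> (\<Prod>i<d. exp (1/20 - 3 * (t i / m - v i)\<^sup>2))"
      unfolding scale by simp
  qed
  \<comment> \<open>The sum over sign vectors of a product over coordinates factorizes, leaving one
    two-term sum per coordinate.\<close>
  also have "\<dots> = (\<Prod>i<d. \<Sum>s\<in>{-1, 1}. exp (1/20 - 3 * (t i / m - s)\<^sup>2))"
    unfolding signs_def by (subst prod_sum_PiE) auto
  also have "\<dots> \<le> (\<Prod>i<d. 6/5)"
    using exp_sq_dist_signs_le by (intro prod_mono) (auto intro: add_nonneg_nonneg)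
  finally show ?thesis by simp
qed

text \<open>Markov's inequality: h exceeds c off the given event, and the complement carries the
  remaining mass.\<close>

lemma nn_integral_ge_of_measure_le:
  assumes M: "prob_space M" and h: "h \<in> borel_measurable M" and c: "0 \<le> c"
  shows "ennreal (c * (1 - measure M {t\<in>space M. h t \<le> c})) \<le> (\<integral>\<^sup>+t. ennreal (h t) \<partial>M)"
proof -
  interpret prob_space M by fact
  let ?E = "{t\<in>space M. h t \<le> c}"
  have E [measurable]: "?E \<in> sets M" using h by measurable
  have "ennreal (c * (1 - measure M ?E)) = ennreal c * emeasure M (space M - ?E)"
    using c by (simp add: emeasure_eq_measure prob_compl ennreal_mult')
  also have "\<dots> = (\<integral>\<^sup>+t. ennreal c * indicator (space M - ?E) t \<partial>M)"
    by (simp add: nn_integral_cmult_indicator)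
  also have "\<dots> \<le> (\<integral>\<^sup>+t. ennreal (h t) \<partial>M)"
    by (intro nn_integral_mono) (auto split: split_indicator intro: ennreal_leI)
  finally show ?thesis .
qed

text \<open>By averaging, some sign vector v has success probability \<open>T v\<close> at most 5/8
  + 3/16 = 13/16. For it the squared error exceeds one sixtieth of the squared norm of the mean with
  probability at least 3/16, and 60 * 16 / 3 = 320.\<close>

lemma exists_risk_ge_private:
  assumes Q: "Q \<in> approx_dp_channels d n \<epsilon> \<delta>" and d: "1 \<le> d"
    and \<epsilon>: "0 < \<epsilon>" and \<delta>: "0 \<le> \<delta>" and k: "1 < k" and r: "0 < r"
    and q: "0 < q" "q \<le> 1" and b: "0 < b" "b \<le> real d / 64"
    and b\<delta>: "\<delta> * (exp b - 1) / \<epsilon> \<le> 1/16" and qb: "8 * real n * q * \<epsilon> \<le> b"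
  shows "\<exists>P\<in>moment_class d k r. ennreal (r\<^sup>2 * (q powr ((k - 1) / k))\<^sup>2 / 320) \<le> risk d n Q P"
proof -
  \<comment> \<open>The scale at which q times the k-th power of the norm of \<open>a * v\<close> is
    exactly r^k.\<close>
  define a where "a = r * q powr (- 1 / k) / sqrt (real d)"
  define m where "m = q * a"
  define f where "f = (\<lambda>v b. \<lambda>i\<in>{..<d}. if b then a * v i else 0 :: real)"
  \<comment> \<open>The all-zero data set, common to all v; the sign vector passed to
    \<open>f\<close> is a placeholder.\<close>
  define x0 where "x0 = dataset n (f (\<lambda>_. 0)) (\<lambda>_. False)"
  define E where "E = (\<lambda>v. {t\<in>space (Rd d). (\<Sum>i<d. (t i - m * v i)\<^sup>2) \<le> m\<^sup>2 * real d / 60})"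
  \<comment> \<open>Probability that the estimate lands in the ball \<open>E v\<close> around the
    mean \<open>m * v\<close> when the data follow the distribution belonging to v.\<close>
  define T where "T = (\<lambda>v. \<Sum>\<omega>\<in>coin_flips n. weight n q \<omega> * measure (Q (dataset n (f v) \<omega>)) (E v))"
  have q0: "0 \<le> q" using q by simp
  have a: "0 < a" unfolding a_def using r q d by simp
  have m: "0 < m" unfolding m_def using a q by simp
  have Qc: "Q \<in> channels d n" using Q by (simp add: approx_dp_channels_def)
  have f: "f v b \<in> space (Rd d)" for v b by (simp add: f_def space_Rd)
  have x0: "dataset n (f v) (\<lambda>_. False) = x0" for v by (simp add: x0_def dataset_def f_def)
  have x0_space: "x0 \<in> space (samples d n)"
    unfolding x0_def by (rule dataset_in_space) (rule f)
  have E [measurable]: "E v \<in> sets (Rd d)" for v unfolding E_def by measurable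

  \<comment> \<open>The 3/16 is 1/16 for the slack plus 1/8, by \<open>qb\<close>, for the Markov
    term.\<close>
  have T_le: "T v \<le> exp b * measure (Q x0) (E v) + 3/16" for v
  proof -
    have "real n * q * \<epsilon> / b \<le> 1/8" using qb b by (simp add: field_simps)
    moreover have "T v \<le> exp b * measure (Q x0) (E v) + \<delta> * (exp b - 1) / \<epsilon> + real n * q * \<epsilon> / b"
      unfolding T_def using private_average[where f = "f v", OF Q E[of v] f q0 q(2) \<epsilon> \<delta> b(1)] by (simp add: x0)
    ultimately show ?thesis using b\<delta> by linarith
  qed

  interpret Q0: prob_space "Q x0" by (rule channel_prob_space(1)[OF Qc x0_space])
  note Q0_sets = channel_prob_space(2,3)[OF Qc x0_space]
  \<comment> \<open>Under one fixed output distribution, the sum of these probabilities is the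
    expected number of sign vectors whose ball contains the output, and the Chernoff bound controls
    that number pointwise.\<close>
  have "(\<Sum>v\<in>signs d. measure (Q x0) (E v)) = (\<Sum>v\<in>signs d. \<integral>t. indicator (E v) t \<partial>Q x0)"
    using E by (simp add: Q0_sets)
  also have "\<dots> = (\<integral>t. (\<Sum>v\<in>signs d. indicator (E v) t) \<partial>Q x0)"
    using E by (intro Bochner_Integration.integral_sum[symmetric])
      (simp add: Q0_sets Q0.emeasure_eq_measure)
  also have "\<dots> \<le> (\<integral>t. (6/5) ^ d \<partial>Q x0)"
  proof (rule integral_mono)
    fix t assume t: "t \<in> space (Q x0)"
    have "(\<Sum>v\<in>signs d. indicator (E v) t)
        = real (card {v\<in>signs d. (\<Sum>i<d. (t i - m * v i)\<^sup>2) \<le> m\<^sup>2 * real d / 60})"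
      using t by (simp add: E_def Q0_sets indicator_def of_bool_def sum.If_cases Int_def)
    also have "\<dots> \<le> (6/5) ^ d" by (rule card_signs_near_le[OF m])
    finally show "(\<Sum>v\<in>signs d. indicator (E v) t) \<le> (6/5 :: real) ^ d" .
  qed (use E in \<open>auto simp: Q0_sets Q0.emeasure_eq_measure\<close>)
  also have "\<dots> = (6/5) ^ d" by (simp add: Q0.prob_space)
  finally have sum_E: "(\<Sum>v\<in>signs d. measure (Q x0) (E v)) \<le> (6/5) ^ d" .
  \<comment> \<open>As b \<le> d / 64, the left side is at most the d-th power of (1 + 1/64 +
    1/64^2) * 6/5, which is below 5/4. Dividing by 2^d leaves (5/8)^d, at most 5/8 since d \<ge>
    1.\<close>
  have "exp b * (6/5) ^ d \<le> (5/8) * 2 ^ d"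
  proof -
    have "exp b \<le> exp (real d * (1/64))" using b by simp
    also have "\<dots> = exp (1/64) ^ d" by (rule exp_of_nat_mult)
    also have "\<dots> \<le> (1 + 1/64 + (1/64)\<^sup>2) ^ d" by (intro power_mono exp_bound) auto
    finally have "exp b * (6/5) ^ d \<le> (1 + 1/64 + (1/64)\<^sup>2) ^ d * (6/5) ^ d"
      by (simp add: mult_right_mono)
    also have "\<dots> = ((1 + 1/64 + (1/64)\<^sup>2) * (6/5)) ^ d" by (rule power_mult_distrib[symmetric])
    also have "\<dots> \<le> (5/8 * 2) ^ d" by (intro power_mono) (auto simp: power2_eq_square)
    also have "\<dots> = (5/8) ^ d * 2 ^ d" by (rule power_mult_distrib)
    also have "\<dots> \<le> (5/8) * 2 ^ d"
      using d power_decreasing[of 1 d "5/8 :: real"] by (intro mult_right_mono) auto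
    finally show ?thesis .
  qed
  have "(\<Sum>v\<in>signs d. T v) \<le> (\<Sum>v\<in>signs d. exp b * measure (Q x0) (E v) + 3/16)"
    by (intro sum_mono T_le)
  also have "\<dots> = exp b * (\<Sum>v\<in>signs d. measure (Q x0) (E v)) + 3/16 * 2 ^ d"
    by (simp add: sum.distrib sum_distrib_left card_signs)
  also have "\<dots> \<le> exp b * (6/5) ^ d + 3/16 * 2 ^ d" using sum_E by simp
  also have "\<dots> \<le> 13/16 * 2 ^ d" using \<open>exp b * (6/5) ^ d \<le> (5/8) * 2 ^ d\<close> by simp
  also have "\<dots> = (\<Sum>v\<in>signs d. 13/16)" by (simp add: card_signs)
  finally have sum_T: "(\<Sum>v\<in>signs d. T v) \<le> (\<Sum>v\<in>signs d. 13/16)" .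
  have nonempty: "signs d \<noteq> {}" by (simp add: signs_def PiE_eq_empty_iff)
  have "\<not> (\<forall>v\<in>signs d. 13/16 < T v)"
    using sum_strict_mono[of "signs d" "\<lambda>_. 13/16" T] sum_T nonempty by force
  then obtain v where v: "v \<in> signs d" "T v \<le> 13/16" by (auto simp: not_less)
  have v_sq: "(v i)\<^sup>2 = 1" if "i < d" for i
  proof -
    have "v i \<in> {-1, 1}" using v(1) that by (auto simp: signs_def PiE_iff)
    then show ?thesis by auto
  qed

  have "two_point d (f v) q \<in> moment_class d k r"
  proof (rule two_point_in_moment_class[OF q0 q(2) f])
    have "(enorm d (f v True))\<^sup>2 = (\<Sum>i<d. a\<^sup>2)"
      unfolding enorm_sq by (intro sum.cong) (auto simp: f_def power_mult_distrib v_sq)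
    also have "\<dots> = (r * q powr (- 1 / k))\<^sup>2"
      using d by (simp add: a_def power_divide)
    finally have "enorm d (f v True) = r * q powr (- 1 / k)"
      by (rule power2_eq_imp_eq) (use r in \<open>simp_all add: enorm_def L2_set_nonneg\<close>)
    moreover have "(enorm d (f v False))\<^sup>2 = 0" unfolding enorm_sq by (simp add: f_def)
    ultimately have "q * enorm d (f v True) powr k + (1 - q) * enorm d (f v False) powr k
        = q * (r powr k * q powr (- 1))"
      using k r by (simp add: powr_mult powr_powr)
    also have "\<dots> = r powr k" using q by (simp add: powr_minus)
    finally show "q * enorm d (f v True) powr k + (1 - q) * enorm d (f v False) powr k \<le> r powr k"
      by simp
  qed
  moreover have "ennreal (r\<^sup>2 * (q powr ((k - 1) / k))\<^sup>2 / 320) \<le> risk d n Q (two_point d (f v) q)"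
  proof -
    let ?c = "m\<^sup>2 * real d / 60"
    have "q * q powr (- 1 / k) = q powr ((k - 1) / k)"
    proof -
      have "q * q powr (- 1 / k) = q powr (1 + - 1 / k)"
        unfolding powr_add using q by simp
      also have "1 + - 1 / k = (k - 1) / k" using k by (simp add: field_simps)
      finally show ?thesis .
    qed
    \<comment> \<open>This is the norm of the mean.\<close>
    then have "m * sqrt (real d) = r * q powr ((k - 1) / k)"
      using d by (simp add: m_def a_def)
    then have "(m * sqrt (real d))\<^sup>2 = (r * q powr ((k - 1) / k))\<^sup>2" by simp
    then have c: "?c * (3/16) = r\<^sup>2 * (q powr ((k - 1) / k))\<^sup>2 / 320"
      by (simp add: power_mult_distrib)
    have "?c * (3/16) \<le> ?c * (1 - T v)" using v by (intro mult_left_mono) auto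
    also have "\<dots> = (\<Sum>\<omega>\<in>coin_flips n. weight n q \<omega> * (?c * (1 - measure (Q (dataset n (f v) \<omega>)) (E v))))"
    proof -
      have "1 - T v = (\<Sum>\<omega>\<in>coin_flips n. weight n q \<omega> * (1 - measure (Q (dataset n (f v) \<omega>)) (E v)))"
        unfolding T_def by (simp add: right_diff_distrib sum_subtractf sum_weight)
      then show ?thesis by (simp only: sum_distrib_left mult.left_commute)
    qed
    finally have "ennreal (?c * (3/16))
        \<le> ennreal (\<Sum>\<omega>\<in>coin_flips n. weight n q \<omega> * (?c * (1 - measure (Q (dataset n (f v) \<omega>)) (E v))))"
      by (rule ennreal_leI)
    also have "\<dots> = (\<Sum>\<omega>\<in>coin_flips n. ennreal (weight n q \<omega>) *
        ennreal (?c * (1 - measure (Q (dataset n (f v) \<omega>)) (E v))))"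
    proof -
      have "0 \<le> ?c * (1 - measure (Q (dataset n (f v) \<omega>)) (E v))" for \<omega>
        using prob_space.prob_le_1[OF channel_prob_space(1)[OF Qc dataset_in_space[OF f]]]
        by (intro mult_nonneg_nonneg) auto
      then show ?thesis
        using weight_nonneg[OF q0 q(2)]
        by (subst sum_ennreal[symmetric]) (simp_all only: ennreal_mult' mult_nonneg_nonneg)
    qed
    also have "\<dots> \<le> (\<Sum>\<omega>\<in>coin_flips n. ennreal (weight n q \<omega>) *
        (\<integral>\<^sup>+t. ennreal (\<Sum>i<d. (t i - m * v i)\<^sup>2) \<partial>Q (dataset n (f v) \<omega>)))"
    proof (intro sum_mono mult_left_mono)
      fix \<omega>
      have x: "dataset n (f v) \<omega> \<in> space (samples d n)" by (rule dataset_in_space) (rule f)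
      note Qx = channel_prob_space[OF Qc x]
      have "(\<lambda>t. \<Sum>i<d. (t i - m * v i)\<^sup>2) \<in> borel_measurable (Q (dataset n (f v) \<omega>))"
        unfolding measurable_cong_sets[OF Qx(2) refl] by measurable
      from nn_integral_ge_of_measure_le[OF Qx(1) this, of ?c]
      show "ennreal (?c * (1 - measure (Q (dataset n (f v) \<omega>)) (E v)))
          \<le> (\<integral>\<^sup>+t. ennreal (\<Sum>i<d. (t i - m * v i)\<^sup>2) \<partial>Q (dataset n (f v) \<omega>))"
        by (simp add: E_def Qx(3))
    qed simp
    also have "\<dots> = risk d n Q (two_point d (f v) q)"
    proof -
      have "(\<Sum>i<d. (t i - m * v i)\<^sup>2) = (\<Sum>i<d. (t i - (q * f v True i + (1 - q) * f v False i))\<^sup>2)" for t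
        by (intro sum.cong) (auto simp: f_def m_def mult.assoc)
      then show ?thesis by (simp only: risk_two_point[OF q0 q(2) f Qc])
    qed
    finally show ?thesis by (simp only: c)
  qed
  ultimately show ?thesis by blast
qed

section \<open>Statistical lower bound from two nearby hypotheses\<close>

text \<open>Each coin has likelihoods 1/2 + h and 1/2 - h under the two hypotheses, in one order or
  the other, so the product is the same for all outcomes.\<close>

lemma weight_mult_weight:
  "weight n (1/2 + h) \<omega> * weight n (1/2 - h) \<omega> = (1/4 - h\<^sup>2) ^ n"
proof -
  have "weight n (1/2 + h) \<omega> * weight n (1/2 - h) \<omega> = (\<Prod>j<n. 1/4 - h\<^sup>2)"
    unfolding weight_def prod.distrib[symmetric]
    by (intro prod.cong) (auto simp: power2_eq_square algebra_simps)
  then show ?thesis by simp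
qed

text \<open>Summed over the samples, this bounds the overlap of two distributions below by their affinity.\<close>

lemma le_min_of_sq_le_mult:
  fixes a b g :: real
  assumes "0 \<le> a" "0 \<le> b" "g\<^sup>2 \<le> a * b"
  shows "g - (a + b) / 4 \<le> min a b"
proof -
  \<comment> \<open>AM-GM for x and y / 4; both orders of a and b are used to reach the
    minimum.\<close>
  have "g \<le> x + y / 4" if "0 \<le> x" "0 \<le> y" "g\<^sup>2 \<le> x * y" for x y :: real
  proof (rule power2_le_imp_le)
    have "(x + y / 4)\<^sup>2 - x * y = (x - y / 4)\<^sup>2" by (simp add: power2_eq_square field_simps)
    moreover have "0 \<le> (x - y / 4)\<^sup>2" by simp
    ultimately show "g\<^sup>2 \<le> (x + y / 4)\<^sup>2" using that(3) by linarith
  qed (use that in simp)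
  from this[of a b] this[of b a] assms show ?thesis
    by (auto simp: min_def mult.commute field_simps)
qed

text \<open>The affinity of the two hypotheses is (1 - 4 h^2)^(n/2). With x for 4 h^2, dropping the
  root leaves the smaller (1 - x)^n, which is at least 1 - n x = 3/4 by Bernoulli's inequality; the
  subtracted weights sum to 2/4.\<close>

lemma sum_min_weight_ge:
  assumes n: "1 \<le> n" and h: "h\<^sup>2 = 1 / (16 * real n)" "0 \<le> h" "h \<le> 1/2"
  shows "1/4 \<le> (\<Sum>\<omega>\<in>coin_flips n. min (weight n (1/2 + h) \<omega>) (weight n (1/2 - h) \<omega>))"
proof -
  define x where "x = 4 * h\<^sup>2"
  have "h\<^sup>2 \<le> (1/2)\<^sup>2" using h by (intro power_mono) auto
  then have x: "0 \<le> x" "x \<le> 1" by (simp_all add: x_def power2_eq_square)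
  have nx: "real n * x = 1/4" using n by (simp add: x_def h)
  define g where "g = ((1 - x) / 2) ^ n"
  have g: "g - (weight n (1/2 + h) \<omega> + weight n (1/2 - h) \<omega>) / 4
      \<le> min (weight n (1/2 + h) \<omega>) (weight n (1/2 - h) \<omega>)" for \<omega>
  proof (rule le_min_of_sq_le_mult)
    have "((1 - x) / 2)\<^sup>2 = (1 - x) * ((1 - x) / 4)" by (simp add: power2_eq_square)
    also have "\<dots> \<le> 1 * ((1 - x) / 4)" using x by (intro mult_right_mono) auto
    also have "\<dots> = 1/4 - h\<^sup>2" by (simp add: x_def)
    finally have "((1 - x) / 2)\<^sup>2 \<le> 1/4 - h\<^sup>2" .
    then have "(((1 - x) / 2)\<^sup>2) ^ n \<le> (1/4 - h\<^sup>2) ^ n" by (rule power_mono) simp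
    moreover have "g\<^sup>2 = (((1 - x) / 2)\<^sup>2) ^ n"
      by (simp add: g_def mult.commute flip: power_mult)
    ultimately show "g\<^sup>2 \<le> weight n (1/2 + h) \<omega> * weight n (1/2 - h) \<omega>"
      by (simp only: weight_mult_weight)
  qed (use h in \<open>auto intro!: weight_nonneg\<close>)
  have "1/4 \<le> 2 ^ n * g - 1/2"
  proof -
    have "1 + real n * (- x) \<le> (1 + - x) ^ n" by (rule Bernoulli_inequality) (use x in simp)
    then have "3/4 \<le> (1 - x) ^ n" using nx by simp
    then show ?thesis by (simp add: g_def power_divide)
  qed
  also have "\<dots> = (\<Sum>\<omega>\<in>coin_flips n. g - (weight n (1/2 + h) \<omega> + weight n (1/2 - h) \<omega>) / 4)"
    by (simp add: sum_subtractf sum.distrib sum_weight card_coin_flips flip: sum_divide_distrib)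
  also have "\<dots> \<le> (\<Sum>\<omega>\<in>coin_flips n. min (weight n (1/2 + h) \<omega>) (weight n (1/2 - h) \<omega>))"
    by (intro sum_mono g)
  finally show ?thesis .
qed

text \<open>Le Cam's two-point method. Both support points have norm r, so the moment constraint
  holds whatever their probabilities; n h^2 = 1/16 keeps the hypotheses hard to tell apart while
  their means are 2 \<mu> apart.\<close>

lemma exists_risk_ge_sampling:
  assumes Q: "Q \<in> channels d n" and d: "1 \<le> d" and n: "1 \<le> n" and r: "0 < r"
  shows "\<exists>P\<in>moment_class d k r. ennreal (r\<^sup>2 / (16 * real n)) \<le> risk d n Q P"
proof -
  define h where "h = 1 / (4 * sqrt (real n))"
  define \<mu> where "\<mu> = 2 * h * r"
  define f where "f = (\<lambda>b. \<lambda>i\<in>{..<d}. if i = 0 then (if b then r else - r) else 0)"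
  define w1 w2 where "w1 = weight n (1/2 + h)" and "w2 = weight n (1/2 - h)"
  define y1 y2 where "y1 = (\<lambda>i. (1/2 + h) * f True i + (1 - (1/2 + h)) * f False i)"
    and "y2 = (\<lambda>i. (1/2 - h) * f True i + (1 - (1/2 - h)) * f False i)"
  define P1 P2 where "P1 = two_point d f (1/2 + h)" and "P2 = two_point d f (1/2 - h)"
  define J where "J = (\<lambda>y \<omega>. \<integral>\<^sup>+t. ennreal (\<Sum>i<d. (t i - y i)\<^sup>2) \<partial>Q (dataset n f \<omega>))"
  have h: "h\<^sup>2 = 1 / (16 * real n)" "0 \<le> h" "h \<le> 1/4"
  proof -
    show "h\<^sup>2 = 1 / (16 * real n)" by (simp add: h_def power_divide power_mult_distrib)
    show "0 \<le> h" by (simp add: h_def)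
    have "1 \<le> sqrt (real n)" using n by simp
    then show "h \<le> 1/4" by (simp add: h_def divide_simps)
  qed
  have \<mu>: "\<mu>\<^sup>2 = r\<^sup>2 / (4 * real n)" by (simp add: \<mu>_def power_mult_distrib h(1))
  have f: "f b \<in> space (Rd d)" for b by (simp add: f_def space_Rd)
  have q: "0 \<le> 1/2 + h" "1/2 + h \<le> 1" "0 \<le> 1/2 - h" "1/2 - h \<le> 1" using h by auto
  have y: "y1 0 = \<mu>" "y2 0 = - \<mu>" using d by (auto simp: y1_def y2_def f_def \<mu>_def algebra_simps)
  have enorm_f: "enorm d (f b) = r" for b
  proof (rule power2_eq_imp_eq)
    have "(enorm d (f b))\<^sup>2 = (\<Sum>i<d. if i = 0 then r\<^sup>2 else 0)"
      unfolding enorm_sq by (intro sum.cong) (auto simp: f_def)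
    then show "(enorm d (f b))\<^sup>2 = r\<^sup>2" using d by (simp add: sum.delta)
  qed (use r in \<open>auto simp: enorm_def L2_set_nonneg\<close>)
  have P: "P1 \<in> moment_class d k r" "P2 \<in> moment_class d k r"
    unfolding P1_def P2_def using q f
    by (auto intro!: two_point_in_moment_class simp: enorm_f algebra_simps)
  have w: "0 \<le> w1 \<omega>" "0 \<le> w2 \<omega>" for \<omega>
    using q by (auto simp: w1_def w2_def weight_nonneg)

  \<comment> \<open>Given the sample, the output has the same law under both hypotheses, and no
    output is close to both means: the two squared errors add up to at least
    \<open>2 * \<mu>\<^sup>2\<close>. Only the smaller weight is kept.\<close>
  have pair: "ennreal (min (w1 \<omega>) (w2 \<omega>) * (2 * \<mu>\<^sup>2))
      \<le> ennreal (w1 \<omega>) * J y1 \<omega> + ennreal (w2 \<omega>) * J y2 \<omega>" for \<omega>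
  proof -
    have x: "dataset n f \<omega> \<in> space (samples d n)" by (rule dataset_in_space) (rule f)
    note Qx = channel_prob_space[OF Q x]
    interpret Qx: prob_space "Q (dataset n f \<omega>)" by fact
    have meas: "(\<lambda>t. \<Sum>i<d. (t i - y i)\<^sup>2) \<in> borel_measurable (Q (dataset n f \<omega>))"
      for y :: "nat \<Rightarrow> real"
      unfolding measurable_cong_sets[OF Qx(2) refl] by measurable
    have sq: "2 * \<mu>\<^sup>2 \<le> (\<Sum>i<d. (t i - y1 i)\<^sup>2) + (\<Sum>i<d. (t i - y2 i)\<^sup>2)" for t
    proof -
      have "2 * \<mu>\<^sup>2 \<le> (t 0 - y1 0)\<^sup>2 + (t 0 - y2 0)\<^sup>2"
      proof -
        have "(t 0 - \<mu>)\<^sup>2 + (t 0 + \<mu>)\<^sup>2 = 2 * \<mu>\<^sup>2 + 2 * (t 0)\<^sup>2"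
          by (simp add: power2_eq_square algebra_simps)
        moreover have "0 \<le> (t 0)\<^sup>2" by simp
        ultimately show ?thesis unfolding y by simp
      qed
      also have "\<dots> \<le> (\<Sum>i<d. (t i - y1 i)\<^sup>2) + (\<Sum>i<d. (t i - y2 i)\<^sup>2)"
        using d by (intro add_mono member_le_sum) auto
      finally show ?thesis .
    qed
    have "ennreal (2 * \<mu>\<^sup>2) = (\<integral>\<^sup>+t. ennreal (2 * \<mu>\<^sup>2) \<partial>Q (dataset n f \<omega>))"
      by (simp add: Qx.emeasure_space_1)
    also have "\<dots> \<le> (\<integral>\<^sup>+t. ennreal (\<Sum>i<d. (t i - y1 i)\<^sup>2) + ennreal (\<Sum>i<d. (t i - y2 i)\<^sup>2)
        \<partial>Q (dataset n f \<omega>))"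
      using sq by (intro nn_integral_mono) (simp add: sum_nonneg ennreal_leI flip: ennreal_plus)
    also have "\<dots> = J y1 \<omega> + J y2 \<omega>"
      unfolding J_def using meas by (intro nn_integral_add) auto
    finally have "ennreal (2 * \<mu>\<^sup>2) \<le> J y1 \<omega> + J y2 \<omega>" .
    then have "ennreal (min (w1 \<omega>) (w2 \<omega>)) * ennreal (2 * \<mu>\<^sup>2)
        \<le> ennreal (min (w1 \<omega>) (w2 \<omega>)) * (J y1 \<omega> + J y2 \<omega>)"
      by (rule mult_left_mono) simp
    also have "\<dots> \<le> ennreal (w1 \<omega>) * J y1 \<omega> + ennreal (w2 \<omega>) * J y2 \<omega>"
      unfolding distrib_left by (intro add_mono mult_right_mono ennreal_leI) auto
    finally show ?thesis using w by (simp add: ennreal_mult)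
  qed
  have "2 * (r\<^sup>2 / (16 * real n)) = (1/4) * (2 * \<mu>\<^sup>2)" by (simp add: \<mu>)
  also have "\<dots> \<le> (\<Sum>\<omega>\<in>coin_flips n. min (w1 \<omega>) (w2 \<omega>)) * (2 * \<mu>\<^sup>2)"
    unfolding w1_def w2_def using h by (intro mult_right_mono sum_min_weight_ge n) auto
  finally have "ennreal (2 * (r\<^sup>2 / (16 * real n)))
      \<le> (\<Sum>\<omega>\<in>coin_flips n. ennreal (min (w1 \<omega>) (w2 \<omega>) * (2 * \<mu>\<^sup>2)))"
    using w by (simp add: ennreal_leI sum_distrib_right)
  also have "\<dots> \<le> (\<Sum>\<omega>\<in>coin_flips n. ennreal (w1 \<omega>) * J y1 \<omega> + ennreal (w2 \<omega>) * J y2 \<omega>)"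
    by (intro sum_mono pair)
  also have "\<dots> = risk d n Q P1 + risk d n Q P2"
    unfolding P1_def P2_def risk_two_point[OF q(1,2) f Q] risk_two_point[OF q(3,4) f Q]
      J_def w1_def w2_def y1_def y2_def by (rule sum.distrib)
  finally have total: "ennreal (2 * (r\<^sup>2 / (16 * real n))) \<le> risk d n Q P1 + risk d n Q P2" .
  show ?thesis
  \<comment> \<open>The two risks sum to at least twice the bound, so they cannot both be below
    it.\<close>
  proof (rule ccontr)
    assume "\<not> ?thesis"
    then have "risk d n Q P1 < ennreal (r\<^sup>2 / (16 * real n))" "risk d n Q P2 < ennreal (r\<^sup>2 / (16 * real n))"
      using P by (auto simp: not_le)
    then have "risk d n Q P1 + risk d n Q P2 < ennreal (r\<^sup>2 / (16 * real n) + r\<^sup>2 / (16 * real n))"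
      by (rule add_mono_ennreal)
    with total show False by simp
  qed
qed

section \<open>Choice of parameters and proof of the rate\<close>

text \<open>The slack splits as \<open>\<delta> / \<epsilon> = \<surd>\<delta> \<surd>(\<delta> / \<epsilon>\<^sup>2)\<close>, and \<open>\<surd>\<delta>\<close> absorbs the logarithm in \<open>b\<close>.\<close>

lemma privacy_slack_le:
  assumes \<delta>: "0 \<le> \<delta>" and \<epsilon>: "0 < \<epsilon>"
    and b: "\<delta> \<noteq> 0 \<Longrightarrow> b \<le> ln (1 / \<delta>) / (64 * sqrt (max 1 (\<delta> / \<epsilon>\<^sup>2)))" "0 \<le> b"
  shows "\<delta> * (exp b - 1) / \<epsilon> \<le> 1/16"
proof (cases "\<delta> = 0")
  case False
  define l t where "l = ln (1 / \<delta>)" and "t = max 1 (\<delta> / \<epsilon>\<^sup>2)"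
  have \<delta>0: "0 < \<delta>" using False \<delta> by simp
  have t: "1 \<le> sqrt t" "sqrt (\<delta> / \<epsilon>\<^sup>2) \<le> sqrt t" by (simp_all add: t_def)
  have bl: "b * (64 * sqrt t) \<le> l" using b(1)[OF False] t by (simp add: l_def t_def pos_le_divide_eq)
  have "b * (64 * 1) \<le> b * (64 * sqrt t)" using b(2) t by (intro mult_left_mono) auto
  \<comment> \<open>The growth of \<open>exp b\<close> then uses up at most half of the decay
    \<open>exp (- l / 2)\<close> of the root of \<delta>.\<close>
  then have b4: "b \<le> l / 4" using bl b(2) by simp
  have "exp b - 1 \<le> b * exp b"
  proof -
    have "(1 - b) * exp b \<le> exp (- b) * exp b"
      using exp_ge_add_one_self[of "- b"] by (intro mult_right_mono) auto
    then show ?thesis by (simp add: algebra_simps flip: exp_add)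
  qed
  also have "\<dots> \<le> b * exp (l / 4)" using b4 b(2) by (intro mult_left_mono) auto
  finally have num: "exp b - 1 \<le> b * exp (l / 4)" .
  have \<delta>_exp: "\<delta> = exp (- l)" using \<delta>0 by (simp add: l_def ln_div)
  have "\<delta> / \<epsilon> = sqrt \<delta> * sqrt (\<delta> / \<epsilon>\<^sup>2)"
    using \<delta>0 \<epsilon> by (simp add: real_sqrt_divide)
  also have "\<dots> \<le> sqrt \<delta> * sqrt t" using t \<delta> by (intro mult_left_mono) auto
  also have "sqrt \<delta> = exp (- l / 2)"
    by (rule real_sqrt_unique) (simp_all add: \<delta>_exp flip: exp_of_nat_mult)
  finally have ratio: "\<delta> / \<epsilon> \<le> exp (- l / 2) * sqrt t" .
  have "\<delta> * (exp b - 1) / \<epsilon> = \<delta> / \<epsilon> * (exp b - 1)" by simp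
  also have "\<dots> \<le> (exp (- l / 2) * sqrt t) * (b * exp (l / 4))"
    using ratio num t b(2) by (intro mult_mono) auto
  also have "\<dots> = (b * (64 * sqrt t)) / 64 * (exp (- l / 2) * exp (l / 4))" by simp
  also have "\<dots> \<le> l / 64 * (exp (- l / 2) * exp (l / 4))"
    using bl by (intro mult_right_mono divide_right_mono) auto
  also have "\<dots> = l / 64 * exp (- (l / 4))" by (simp flip: exp_add)
  also have "\<dots> \<le> 1/16"
  proof -
    \<comment> \<open>Since l / 64 is one sixteenth of l / 4, this leaves 1/16.\<close>
    have "l / 4 \<le> exp (l / 4)" using exp_ge_add_one_self[of "l / 4"] by linarith
    then show ?thesis by (simp add: exp_minus field_simps)
  qed
  finally show ?thesis .
qed simp

lemma ennreal_add_half_le: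
  assumes "0 \<le> x" "0 \<le> y" "ennreal x \<le> S" "ennreal y \<le> S"
  shows "ennreal ((x + y) / 2) \<le> S"
proof -
  have "ennreal ((x + y) / 2) \<le> ennreal (max x y)" by (rule ennreal_leI) simp
  also have "\<dots> \<le> S" using assms(3,4) by (simp add: max_def)
  finally show ?thesis .
qed

theorem proposition4:
  fixes k :: real
  assumes "1 < k"
  shows "\<exists>c :: real \<Rightarrow> real. antimono c \<and> (\<forall>t. 0 < c t) \<and>
           (\<forall>(d::nat) (n::nat) (r::real) (\<epsilon>::real) (\<delta>::real).
              1 \<le> d \<longrightarrow> 1 \<le> n \<longrightarrow> 0 < r \<longrightarrow> 0 < \<epsilon> \<longrightarrow> 0 \<le> \<delta> \<longrightarrow> \<delta> \<le> 1 \<longrightarrow>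
              ennreal (c (\<delta> / \<epsilon>\<^sup>2) * lower_rate d n k r \<epsilon> \<delta>) \<le> minimax_risk d n k r \<epsilon> \<delta>)"
proof (intro exI conjI allI impI)
  \<comment> \<open>The private bound is used with b = \<open>C * M\<close>, where C is the value of
    \<open>c0\<close> at \<open>\<delta> / \<epsilon>\<^sup>2\<close>: the 64 ensures b \<le> d /
    64, and the root keeps the slack below 1/16.\<close>
  define c0 where "c0 = (\<lambda>t. 1 / (64 * sqrt (max 1 t)) :: real)"
  have c0: "0 < c0 t" "c0 t \<le> 1/64" for t
  proof -
    have "1 \<le> sqrt (max 1 t)" by simp
    then show "0 < c0 t" "c0 t \<le> 1/64" by (simp_all add: c0_def divide_simps)
  qed
  \<comment> \<open>40960 = 64 * 320 * 2: 64 from (C / 8)^2, 320 from the private bound, 2 from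
    passing from the larger of two terms to their sum.\<close>
  show "antimono (\<lambda>t. (c0 t)\<^sup>2 / 40960)"
  proof (intro antimonoI divide_right_mono power_mono)
    fix s t :: real assume "s \<le> t"
    then have "sqrt (max 1 s) \<le> sqrt (max 1 t)" by simp
    moreover have "1 \<le> sqrt (max 1 s)" by simp
    ultimately show "c0 t \<le> c0 s" unfolding c0_def by (intro divide_left_mono) auto
  qed (use c0 in \<open>auto intro: less_imp_le\<close>)
  show "0 < (c0 t)\<^sup>2 / 40960" for t using c0(1)[of t] by simp
  fix d n :: nat and r \<epsilon> \<delta> :: real
  assume d: "1 \<le> d" and n: "1 \<le> n" and r: "0 < r" and \<epsilon>: "0 < \<epsilon>" and \<delta>: "0 \<le> \<delta>" "\<delta> \<le> 1"
  define C where "C = c0 (\<delta> / \<epsilon>\<^sup>2)"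
  have C: "0 < C" "C \<le> 1/64" using c0 by (auto simp: C_def)
  define M where "M = (if \<delta> = 0 then real d else min (real d) (ln (1 / \<delta>)))"
  define e where "e = (k - 1) / k"
  define X where "X = M\<^sup>2 / ((real n)\<^sup>2 * \<epsilon>\<^sup>2)"
  have e: "0 < e" "e < 1" using \<open>1 < k\<close> by (auto simp: e_def)
  have ln: "\<delta> \<noteq> 0 \<Longrightarrow> 0 \<le> ln (1 / \<delta>)" using \<delta> by simp
  have M: "0 \<le> M" "M \<le> real d" using ln by (auto simp: M_def)
  have rate: "lower_rate d n k r \<epsilon> \<delta> = r\<^sup>2 / real n + r\<^sup>2 * min (X powr e) 1"
  proof -
    \<comment> \<open>Squaring commutes with the minimum because the logarithm is nonnegative for
      \<delta> \<le> 1.\<close>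
    have "min_dim_log d \<delta> = M\<^sup>2"
      using ln power_mono[of "real d" "ln (1 / \<delta>)" 2] power_mono[of "ln (1 / \<delta>)" "real d" 2]
      by (auto simp: min_dim_log_def M_def min_def)
    then show ?thesis by (simp add: lower_rate_def X_def e_def)
  qed
  show "ennreal ((c0 (\<delta> / \<epsilon>\<^sup>2))\<^sup>2 / 40960 * lower_rate d n k r \<epsilon> \<delta>) \<le> minimax_risk d n k r \<epsilon> \<delta>"
    unfolding minimax_risk_def C_def[symmetric]
  proof (rule INF_greatest)
    fix Q assume Q: "Q \<in> approx_dp_channels d n \<epsilon> \<delta>"
    let ?S = "SUP P\<in>moment_class d k r. risk d n Q P"
    have Qc: "Q \<in> channels d n" using Q by (simp add: approx_dp_channels_def)
    have sampling: "ennreal (C\<^sup>2 / 20480 * (r\<^sup>2 / real n)) \<le> ?S"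
    proof -
      have "C\<^sup>2 \<le> 1\<^sup>2" using C by (intro power_mono) auto
      then have "C\<^sup>2 / 20480 * (r\<^sup>2 / real n) \<le> 1/16 * (r\<^sup>2 / real n)"
        by (intro mult_right_mono) auto
      then have "ennreal (C\<^sup>2 / 20480 * (r\<^sup>2 / real n)) \<le> ennreal (r\<^sup>2 / (16 * real n))"
        by (intro ennreal_leI) simp
      moreover obtain P where P: "P \<in> moment_class d k r"
          "ennreal (r\<^sup>2 / (16 * real n)) \<le> risk d n Q P"
        using exists_risk_ge_sampling[OF Qc d n r] by blast
      ultimately show ?thesis by (intro SUP_upper2[OF P(1)]) (rule order_trans)
    qed
    have privacy: "ennreal (C\<^sup>2 / 20480 * (r\<^sup>2 * min (X powr e) 1)) \<le> ?S"
    proof (cases "M = 0")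
      \<comment> \<open>This happens only for \<delta> = 1, where X and hence the whole term vanish;
        the private bound requires a positive b.\<close>
      case True
      then show ?thesis by (simp add: X_def)
    next
      case False
      then have M0: "0 < M" using M by simp
      \<comment> \<open>The largest q with \<open>8 * real n * q * \<epsilon>\<close> at most b,
        capped at 1.\<close>
      define q where "q = min 1 (C * M / (8 * real n * \<epsilon>))"
      have q: "0 < q" "q \<le> 1" using C M0 n \<epsilon> by (auto simp: q_def)
      have "q \<le> C * M / (8 * real n * \<epsilon>)" by (simp add: q_def)
      then have qb: "8 * real n * q * \<epsilon> \<le> C * M"
        using n \<epsilon> by (simp add: pos_le_divide_eq mult_ac)
      have CM: "0 < C * M" "C * M \<le> real d / 64"
        using C M M0 mult_mono[of C "1/64" M "real d"] by auto
      have slack: "\<delta> * (exp (C * M) - 1) / \<epsilon> \<le> 1/16"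
      proof (rule privacy_slack_le[OF \<delta>(1) \<epsilon>])
        assume "\<delta> \<noteq> 0"
        then have "M \<le> ln (1 / \<delta>)" by (simp add: M_def)
        then have "C * M \<le> C * ln (1 / \<delta>)" using C by simp
        then show "C * M \<le> ln (1 / \<delta>) / (64 * sqrt (max 1 (\<delta> / \<epsilon>\<^sup>2)))"
          by (simp add: C_def c0_def)
      qed (use CM in simp)
      obtain P where P: "P \<in> moment_class d k r" "ennreal (r\<^sup>2 * (q powr e)\<^sup>2 / 320) \<le> risk d n Q P"
        using exists_risk_ge_private[OF Q d \<epsilon> \<delta>(1) \<open>1 < k\<close> r q CM slack qb] by (auto simp: e_def)
      have X: "0 \<le> X" by (simp add: X_def)
      have "C\<^sup>2 / 64 * min (X powr e) 1 \<le> (q powr e)\<^sup>2"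
      proof -
        \<comment> \<open>\<open>(C / 8)\<^sup>2 * X\<close> is the square of q before capping; the
          cap on X matches the one on q.\<close>
        have "(C / 8)\<^sup>2 * min X 1 \<le> q\<^sup>2"
        proof (cases "1 \<le> C * M / (8 * real n * \<epsilon>)")
          case True
          have "(C / 8)\<^sup>2 \<le> 1\<^sup>2" using C by (intro power_mono) auto
          then have "(C / 8)\<^sup>2 * min X 1 \<le> 1 * 1" using X by (intro mult_mono) auto
          then show ?thesis using True by (simp add: q_def)
        next
          case False
          have "(C / 8)\<^sup>2 * min X 1 \<le> (C / 8)\<^sup>2 * X" by (intro mult_left_mono) auto
          also have "\<dots> = (C * M / (8 * real n * \<epsilon>))\<^sup>2"
            by (simp add: X_def power_mult_distrib power_divide)
          finally show ?thesis using False by (simp add: q_def)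
        qed
        then have "((C / 8)\<^sup>2 * min X 1) powr e \<le> (q\<^sup>2) powr e"
          using e X by (intro powr_mono2) auto
        moreover have "(q\<^sup>2) powr e = (q powr e)\<^sup>2"
          using q by (simp add: power2_eq_square powr_mult)
        moreover have "((C / 8)\<^sup>2 * min X 1) powr e = ((C / 8)\<^sup>2) powr e * min X 1 powr e"
          using X by (simp add: powr_mult)
        moreover have "min X 1 powr e = min (X powr e) 1"
          using X e powr_le1[of e X] ge_one_powr_ge_zero[of X e] by (cases "X \<le> 1") (auto simp: min_def)
        \<comment> \<open>A number in [0, 1] does not decrease under a power e < 1, so the final
          constant is free of k.\<close>
        moreover have "(C / 8)\<^sup>2 powr 1 \<le> (C / 8)\<^sup>2 powr e"
        proof (rule powr_mono')
          have "(C / 8)\<^sup>2 \<le> 1\<^sup>2" using C by (intro power_mono) auto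
          then show "(C / 8)\<^sup>2 \<le> 1" by simp
        qed (use e in auto)
        ultimately show ?thesis
          using mult_right_mono[of "(C / 8)\<^sup>2" "(C / 8)\<^sup>2 powr e" "min (X powr e) 1"] C
          by (simp add: power_divide)
      qed
      then have "r\<^sup>2 * (C\<^sup>2 / 64 * min (X powr e) 1) / 320 \<le> r\<^sup>2 * (q powr e)\<^sup>2 / 320"
        by (intro divide_right_mono mult_left_mono) auto
      then have "ennreal (C\<^sup>2 / 20480 * (r\<^sup>2 * min (X powr e) 1)) \<le> ennreal (r\<^sup>2 * (q powr e)\<^sup>2 / 320)"
        by (intro ennreal_leI) (simp add: mult_ac)
      also note P(2)
      finally show ?thesis by (rule SUP_upper2[OF P(1)])
    qed
    have "ennreal ((C\<^sup>2 / 20480 * (r\<^sup>2 / real n) + C\<^sup>2 / 20480 * (r\<^sup>2 * min (X powr e) 1)) / 2) \<le> ?S"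
      by (rule ennreal_add_half_le[OF _ _ sampling privacy]) auto
    also have "(C\<^sup>2 / 20480 * (r\<^sup>2 / real n) + C\<^sup>2 / 20480 * (r\<^sup>2 * min (X powr e) 1)) / 2
        = C\<^sup>2 / 40960 * lower_rate d n k r \<epsilon> \<delta>"
      by (simp add: rate field_simps)
    finally show "ennreal (C\<^sup>2 / 40960 * lower_rate d n k r \<epsilon> \<delta>) \<le> ?S" .
  qed
qed

end
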